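(* Let $1<\beta\le2$, $t\in\mathbb R$, and let $\lambda\in\mathbb C$ be an isolated eigenvalue of $\mathcal L_t:\mathcal F\to\mathcal F$ with $|\lambda|>r_t$. For every non-zero eigenfunctional $\nu_\lambda\in\mathcal F^*$ of $\lambda$ (that is, $\mathcal L_t^*\nu_\lambda=\lambda\nu_\lambda$) we have $$\nu_\lambda(\chi_{[\underline0,\underline a]})=\nu_\lambda(\chi_{[\underline0,\underline1]})\cdot\sum_{n=1}^\infty\frac{a_nH_{n-1}(t,\underline a)}{\lambda^n}$$ for every $\underline a=(a_i)_{i=1}^\infty\in X_\beta$. In addition, $\nu_\lambda(\chi_{[\underline0,\underline1]})\ne0$.
   Context: For $1<\beta\le2$, $\tau_\beta(x)=\beta x-[\beta x]$ on $[0,1]$ and $g_n(x)=[\beta\tau_\beta^{n-1}(x)]$ are the greedy digits of $x$. $\{0,1\}^{\mathbb N}$ carries the product topology, the lexicographic order $\preceq$ and the left shift $\sigma$. $\underline0=000\cdots$ and $\underline1=(q_n(1))_{n\ge1}:=\lim_{y\nearrow1}(g_n(y))_{n\ge1}$ (quasi-greedy expansion of $1$). The beta-shift is $X_\beta=\{\underline x\in\{0,1\}^{\mathbb N}:\sigma^n(\underline x)\preceq\underline1\ \forall n\ge0\}$ with the map $\sigma$. For $\underline a,\underline b\in X_\beta$, $[\underline a,\underline b]=\{\underline x\in X_\beta:\underline a\preceq\underline x\preceq\underline b\}$; $\chi_A$ is the indicator function of $A$. Function spaces: for $f:X_\beta\to\mathbb C$, $\mathrm{var}(f)$ is the supremum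 of $\sum_{i=1}^n|f(x_i)-f(x_{i-1})|$ over finite chains $\underline0=x_0\prec x_1\prec\dots\prec x_n=\underline1$ in $X_\beta$; $BV=\{f:\mathrm{var}(f)<\infty\}$ with norm $\|f\|_{BV}=|f|_\infty+\mathrm{var}(f)$, $|f|_\infty=\sup|f|$. $\mathcal N$ is the set of $f\in BV$ vanishing off a countable set, $\mathcal B=BV/\mathcal N$ with the quotient norm, and $\mathcal F\subset\mathcal B$ is the closure in $\mathcal B$ of the linear span of indicator functions of intervals in $X_\beta$. $\mathcal F^*$ is the dual Banach space. Operator: $C_1=\{(x_i)\in X_\beta:x_1=1\}$; $\mathcal L_tf(x)=\sum_{y:\sigma(y)=x}e^{t\chi_{C_1}(y)}f(y)$, a bounded operator on $\mathcal F$; $\mathcal L_t^*\nu=\nu\circ\mathcal L_t$. $r_t=\limsup_{n\to\infty}|e^{tS_n\chi_{C_1}}|_\infty^{1/n}$ with $S_nf=\sum_{i=0}^{n-1}f\circ\sigma^i$. For $\underline x=(x_i)\in X_\beta$: $H_0(t,\underline x)=1$, $H_n(t,\underline x)=\exp(t\sum_{i=1}^nx_i)$ for $n\ge1$. *)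

theory Defs
  imports "HOL-Analysis.Analysis" "HOL-Library.Fun_Lexorder"
begin

section \<open>The beta-shift\<close>

text \<open>Sequences are indexed from 0: the \<open>i\<close>-th digit \<open>x\<^sub>i\<close> (\<open>i \<ge> 1\<close>) is \<open>x (i - 1)\<close>.\<close>

definition tau :: "real \<Rightarrow> real \<Rightarrow> real" where
  "tau \<beta> x = \<beta> * x - of_int \<lfloor>\<beta> * x\<rfloor>"

definition greedy :: "real \<Rightarrow> real \<Rightarrow> nat \<Rightarrow> nat" where
  "greedy \<beta> x = (\<lambda>n. nat \<lfloor>\<beta> * (tau \<beta> ^^ n) x\<rfloor>)"

text \<open>The limit is taken in the product topology of \<open>nat \<Rightarrow> nat\<close> (discrete factors).\<close>

definition seq_one :: "real \<Rightarrow> nat \<Rightarrow> nat" where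
  "seq_one \<beta> = (THE q. (greedy \<beta> \<longlongrightarrow> q) (at_left 1))"

definition seq_zero :: "nat \<Rightarrow> nat" where
  "seq_zero = (\<lambda>n. 0)"

definition shift :: "(nat \<Rightarrow> nat) \<Rightarrow> nat \<Rightarrow> nat" where
  "shift x = (\<lambda>n. x (Suc n))"

definition lex_le :: "(nat \<Rightarrow> nat) \<Rightarrow> (nat \<Rightarrow> nat) \<Rightarrow> bool" where
  "lex_le x y \<longleftrightarrow> less_fun x y \<or> x = y"

definition beta_shift :: "real \<Rightarrow> (nat \<Rightarrow> nat) set" where
  "beta_shift \<beta> = {x. range x \<subseteq> {0, 1} \<and> (\<forall>n. lex_le ((shift ^^ n) x) (seq_one \<beta>))}"

definition seq_interval :: "real \<Rightarrow> (nat \<Rightarrow> nat) \<Rightarrow> (nat \<Rightarrow> nat) \<Rightarrow> (nat \<Rightarrow> nat) set" where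
  "seq_interval \<beta> a b = {x \<in> beta_shift \<beta>. lex_le a x \<and> lex_le x b}"

definition cyl_one :: "real \<Rightarrow> (nat \<Rightarrow> nat) set" where
  "cyl_one \<beta> = {x \<in> beta_shift \<beta>. x 0 = 1}"

section \<open>Functions of bounded variation\<close>

text \<open>
  A function on \<open>X = beta_shift \<beta>\<close> is represented by a total function on sequences, whose values
  outside \<open>X\<close> never matter: they enter neither the sup norm nor the variation, and functions
  agreeing on \<open>X\<close> differ by an element of \<open>null_fun \<beta>\<close>, so they have the same class in the
  quotient \<open>B_space \<beta>\<close>.
\<close>

type_synonym seqfun = "(nat \<Rightarrow> nat) \<Rightarrow> complex"

definition sup_norm :: "real \<Rightarrow> seqfun \<Rightarrow> real" where
  "sup_norm \<beta> f = (SUP x\<in>beta_shift \<beta>. norm (f x))"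

definition is_chain :: "real \<Rightarrow> nat \<Rightarrow> (nat \<Rightarrow> nat \<Rightarrow> nat) \<Rightarrow> bool" where
  "is_chain \<beta> n x \<longleftrightarrow> (\<forall>i\<le>n. x i \<in> beta_shift \<beta>) \<and> x 0 = seq_zero \<and> x n = seq_one \<beta> \<and>
     (\<forall>i<n. less_fun (x i) (x (Suc i)))"

definition var_sums :: "real \<Rightarrow> seqfun \<Rightarrow> real set" where
  "var_sums \<beta> f = {\<Sum>i=1..n. norm (f (x i) - f (x (i - 1))) |n x. is_chain \<beta> n x}"

definition var :: "real \<Rightarrow> seqfun \<Rightarrow> real" where
  "var \<beta> f = Sup (var_sums \<beta> f)"

definition BV :: "real \<Rightarrow> seqfun set" where
  "BV \<beta> = {f. bdd_above (var_sums \<beta> f)}"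

definition bv_norm :: "real \<Rightarrow> seqfun \<Rightarrow> real" where
  "bv_norm \<beta> f = sup_norm \<beta> f + var \<beta> f"

definition null_fun :: "real \<Rightarrow> seqfun set" where
  "null_fun \<beta> = {f \<in> BV \<beta>. countable {x \<in> beta_shift \<beta>. f x \<noteq> 0}}"

section \<open>The quotient of BV by the null functions\<close>

definition null_rel :: "real \<Rightarrow> (seqfun \<times> seqfun) set" where
  "null_rel \<beta> = {(f, g). f \<in> BV \<beta> \<and> g \<in> BV \<beta> \<and> (\<lambda>x. f x - g x) \<in> null_fun \<beta>}"

definition B_space :: "real \<Rightarrow> seqfun set set" where
  "B_space \<beta> = BV \<beta> // null_rel \<beta>"

definition cls :: "real \<Rightarrow> seqfun \<Rightarrow> seqfun set" where
  "cls \<beta> f = null_rel \<beta> `` {f}"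

text \<open>Operations on classes: each union below is over representatives and consists of copies of
  one and the same class.\<close>

definition q_zero :: "real \<Rightarrow> seqfun set" where
  "q_zero \<beta> = cls \<beta> (\<lambda>x. 0)"

definition q_add :: "real \<Rightarrow> seqfun set \<Rightarrow> seqfun set \<Rightarrow> seqfun set" where
  "q_add \<beta> A B = (\<Union>f\<in>A. \<Union>g\<in>B. cls \<beta> (\<lambda>x. f x + g x))"

definition q_scale :: "real \<Rightarrow> complex \<Rightarrow> seqfun set \<Rightarrow> seqfun set" where
  "q_scale \<beta> c A = (\<Union>f\<in>A. cls \<beta> (\<lambda>x. c * f x))"

definition q_diff :: "real \<Rightarrow> seqfun set \<Rightarrow> seqfun set \<Rightarrow> seqfun set" where
  "q_diff \<beta> A B = q_add \<beta> A (q_scale \<beta> (-1) B)"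

definition q_norm :: "real \<Rightarrow> seqfun set \<Rightarrow> real" where
  "q_norm \<beta> A = (INF f\<in>A. bv_norm \<beta> f)"

text \<open>Linear combinations of indicator functions of intervals.\<close>

definition step_fun :: "real \<Rightarrow> seqfun set" where
  "step_fun \<beta> = {\<lambda>x. \<Sum>k<n. c k * indicator (seq_interval \<beta> (a k) (b k)) x |(n::nat) c a b.
     \<forall>k<n. a k \<in> beta_shift \<beta> \<and> b k \<in> beta_shift \<beta>}"

definition F_space :: "real \<Rightarrow> seqfun set set" where
  "F_space \<beta> = {A \<in> B_space \<beta>. \<forall>\<epsilon>>0. \<exists>s\<in>step_fun \<beta>. q_norm \<beta> (q_diff \<beta> A (cls \<beta> s)) < \<epsilon>}"

text \<open>Bounded linear functionals on \<open>F_space \<beta>\<close>; values outside \<open>F_space \<beta>\<close> are irrelevant.\<close>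

definition F_dual :: "real \<Rightarrow> (seqfun set \<Rightarrow> complex) set" where
  "F_dual \<beta> = {\<nu>.
     (\<forall>A\<in>F_space \<beta>. \<forall>B\<in>F_space \<beta>. \<nu> (q_add \<beta> A B) = \<nu> A + \<nu> B) \<and>
     (\<forall>c. \<forall>A\<in>F_space \<beta>. \<nu> (q_scale \<beta> c A) = c * \<nu> A) \<and>
     (\<exists>K. \<forall>A\<in>F_space \<beta>. norm (\<nu> A) \<le> K * q_norm \<beta> A)}"

section \<open>The transfer operator\<close>

definition transfer_fun :: "real \<Rightarrow> real \<Rightarrow> seqfun \<Rightarrow> seqfun" where
  "transfer_fun \<beta> t f =
     (\<lambda>x. \<Sum>y | y \<in> beta_shift \<beta> \<and> shift y = x. of_real (exp (t * indicator (cyl_one \<beta>) y)) * f y)"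

definition transfer :: "real \<Rightarrow> real \<Rightarrow> seqfun set \<Rightarrow> seqfun set" where
  "transfer \<beta> t A = (\<Union>f\<in>A. cls \<beta> (transfer_fun \<beta> t f))"

definition transfer_dual ::
    "real \<Rightarrow> real \<Rightarrow> (seqfun set \<Rightarrow> complex) \<Rightarrow> seqfun set \<Rightarrow> complex" where
  "transfer_dual \<beta> t \<nu> = \<nu> \<circ> transfer \<beta> t"

definition eigenvalue :: "real \<Rightarrow> real \<Rightarrow> complex \<Rightarrow> bool" where
  "eigenvalue \<beta> t \<mu> \<longleftrightarrow>
     (\<exists>A\<in>F_space \<beta>. A \<noteq> q_zero \<beta> \<and> transfer \<beta> t A = q_scale \<beta> \<mu> A)"

definition resolvent_set :: "real \<Rightarrow> real \<Rightarrow> complex set" where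
  "resolvent_set \<beta> t = {\<mu>.
     bij_betw (\<lambda>A. q_diff \<beta> (q_scale \<beta> \<mu> A) (transfer \<beta> t A)) (F_space \<beta>) (F_space \<beta>) \<and>
     (\<exists>K. \<forall>A\<in>F_space \<beta>.
        q_norm \<beta> A \<le> K * q_norm \<beta> (q_diff \<beta> (q_scale \<beta> \<mu> A) (transfer \<beta> t A)))}"

definition spectrum_on_F :: "real \<Rightarrow> real \<Rightarrow> complex set" where
  "spectrum_on_F \<beta> t = - resolvent_set \<beta> t"

definition isolated_eigenvalue :: "real \<Rightarrow> real \<Rightarrow> complex \<Rightarrow> bool" where
  "isolated_eigenvalue \<beta> t \<mu> \<longleftrightarrow> eigenvalue \<beta> t \<mu> \<and> \<mu> isolated_in spectrum_on_F \<beta> t"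

definition birkhoff_sum :: "nat \<Rightarrow> ((nat \<Rightarrow> nat) \<Rightarrow> real) \<Rightarrow> (nat \<Rightarrow> nat) \<Rightarrow> real" where
  "birkhoff_sum n f x = (\<Sum>i<n. f ((shift ^^ i) x))"

definition r_bound :: "real \<Rightarrow> real \<Rightarrow> ereal" where
  "r_bound \<beta> t = limsup (\<lambda>n. ereal (root n
     (sup_norm \<beta> (\<lambda>x. of_real (exp (t * birkhoff_sum n (indicator (cyl_one \<beta>)) x))))))"

definition H :: "nat \<Rightarrow> real \<Rightarrow> (nat \<Rightarrow> nat) \<Rightarrow> real" where
  "H n t x = exp (t * (\<Sum>i<n. real (x i)))"

definition chi_cls :: "real \<Rightarrow> (nat \<Rightarrow> nat) \<Rightarrow> (nat \<Rightarrow> nat) \<Rightarrow> seqfun set" where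
  "chi_cls \<beta> a b = cls \<beta> (indicator (seq_interval \<beta> a b))"

end

theory Submission
  imports Defs
begin

text \<open>
  Let \<open>q\<close> be the quasi-greedy expansion of 1 and \<open>\<phi>(a) = \<nu>(\<chi>\<^bsub>[0, a]\<^esub>)\<close>. Counting the preimages of a
  point under the shift gives \<open>\<L>\<^sub>t \<chi>\<^bsub>[0, a]\<^esub> = a\<^sub>0 \<chi>\<^bsub>[0, q]\<^esub> + exp (t a\<^sub>0) \<chi>\<^bsub>[0, \<sigma> a]\<^esub>\<close>, hence
  \<open>l \<phi>(a) = a\<^sub>0 \<phi>(q) + exp (t a\<^sub>0) \<phi>(\<sigma> a)\<close>. Iterating this \<open>N\<close> times produces the partial sums of
  the series, with remainder \<open>H\<^sub>N(t, a) l\<^sup>-\<^sup>N \<phi>(\<sigma>\<^sup>N a)\<close>; it tends to 0 because \<open>\<phi>\<close> is bounded and \<open>H\<^sub>N\<close>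
  grows slower than \<open>|l|\<^sup>N\<close>. If \<open>\<phi>(q) = 0\<close> then \<open>\<phi> = 0\<close>, so \<open>\<nu>\<close> vanishes on all step functions
  and, by density, on \<open>\<F>\<close>.
\<close>

section \<open>Lexicographic order, the shift and its inverse branches\<close>

lemma less_fun_linear: "less_fun x y \<or> x = y \<or> less_fun y x" for x y :: "nat \<Rightarrow> nat"
proof (cases "x = y")
  case False
  then have "\<exists>k. x k \<noteq> y k" by auto
  define k where "k = (LEAST k. x k \<noteq> y k)"
  have "x k \<noteq> y k"
    unfolding k_def by (rule LeastI_ex) fact
  moreover have "x i = y i" if "i < k" for i
    using not_less_Least[OF that[unfolded k_def]] by simp
  ultimately show ?thesis
    unfolding less_fun_def by (metis linorder_neq_iff)
qed simp

lemma lex_le_trans: "lex_le x y \<Longrightarrow> lex_le y z \<Longrightarrow> lex_le x z"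
  unfolding lex_le_def by (auto intro: less_fun_trans)

lemma not_lex_le: "\<not> lex_le x y \<longleftrightarrow> less_fun y x"
  unfolding lex_le_def using less_fun_linear[of x y] less_fun_asym less_fun_irrefl by blast

lemma seq_zero_lex_le: "lex_le seq_zero x"
  by (metis less_fun_def not_less_zero not_lex_le seq_zero_def)

text \<open>\<open>case_nat c x\<close> is \<open>x\<close> with the digit \<open>c\<close> put in
  front, so \<open>case_nat 0\<close> and \<open>case_nat 1\<close> serve as the inverse branches of
  the shift.\<close>

lemma shift_case_nat [simp]: "shift (case_nat c x) = x"
  by (simp add: shift_def)

lemma case_nat_shift: "case_nat (x 0) (shift x) = x"
  by (rule ext) (simp add: shift_def split: nat.split)

lemma shift_eq_iff: "shift y = x \<longleftrightarrow> y = case_nat (y 0) x"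
  by (metis case_nat_shift shift_case_nat)

lemma funpow_shift: "(shift ^^ n) x = (\<lambda>k. x (n + k))"
  by (induction n arbitrary: x) (simp_all add: shift_def)

lemma less_fun_case_nat [simp]: "less_fun (case_nat c x) (case_nat c y) \<longleftrightarrow> less_fun x y"
proof
  assume "less_fun x y"
  then obtain k where "x k < y k" "\<forall>i<k. x i = y i"
    unfolding less_fun_def by blast
  then show "less_fun (case_nat c x) (case_nat c y)"
    unfolding less_fun_def by (intro exI[of _ "Suc k"]) (auto split: nat.split)
next
  assume "less_fun (case_nat c x) (case_nat c y)"
  then obtain k where k: "case_nat c x k < case_nat c y k"
    "\<forall>i<k. case_nat c x i = case_nat c y i"
    unfolding less_fun_def by blast
  then obtain j where "k = Suc j" by (cases k) auto
  with k show "less_fun x y"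
    unfolding less_fun_def by (intro exI[of _ j]) force
qed

lemma lex_le_case_nat [simp]: "lex_le (case_nat c x) (case_nat c y) \<longleftrightarrow> lex_le x y"
  unfolding lex_le_def by (metis less_fun_case_nat shift_case_nat)

lemma less_fun_head: "x 0 < y 0 \<Longrightarrow> less_fun x y" for x y :: "nat \<Rightarrow> nat"
  unfolding less_fun_def by (intro exI[of _ 0]) simp

section \<open>The quasi-greedy expansion of 1\<close>

text \<open>Left-limit version of \<open>tau\<close>: as z increases to L, its floor is eventually
  the ceiling of L minus 1. Values therefore lie in (0, 1] instead of [0, 1).\<close>

definition quasi_map :: "real \<Rightarrow> real \<Rightarrow> real" where
  "quasi_map \<beta> x = \<beta> * x - of_int (\<lceil>\<beta> * x\<rceil> - 1)"

definition quasi_greedy :: "real \<Rightarrow> real \<Rightarrow> nat \<Rightarrow> nat" where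
  "quasi_greedy \<beta> x = (\<lambda>n. nat (\<lceil>\<beta> * (quasi_map \<beta> ^^ n) x\<rceil> - 1))"

lemma eventually_floor_at_left:
  fixes L :: real
  shows "\<forall>\<^sub>F z in at_left L. \<lfloor>z\<rfloor> = \<lceil>L\<rceil> - 1"
proof -
  have "real_of_int (\<lceil>L\<rceil> - 1) < L" by linarith
  then have "\<forall>\<^sub>F z in at_left L. z \<in> {real_of_int (\<lceil>L\<rceil> - 1)<..<L}"
    by (rule eventually_at_left_real)
  then show ?thesis
    by eventually_elim (auto simp: floor_eq_iff, linarith)
qed

lemma quasi_map_bounds: "0 < quasi_map \<beta> x" "quasi_map \<beta> x \<le> 1"
  unfolding quasi_map_def by linarith+

lemma filterlim_mult_at_left:
  fixes \<beta> L :: real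
  assumes "0 < \<beta>"
  shows "filterlim (\<lambda>z. \<beta> * z) (at_left (\<beta> * L)) (at_left L)"
  unfolding filterlim_at
proof
  show "\<forall>\<^sub>F z in at_left L. \<beta> * z \<in> {..<\<beta> * L} \<and> \<beta> * z \<noteq> \<beta> * L"
    using eventually_at_left_real[of "L - 1" L, simplified] by eventually_elim (use assms in auto)
qed (auto intro!: tendsto_intros)

text \<open>Just left of L the floor is constant, so \<open>tau\<close> is an increasing affine map
  there and approaches its limit strictly from below. Keeping \<open>at_left\<close> in the target,
  rather than a plain limit, is what allows iteration.\<close>

lemma filterlim_tau_at_left:
  assumes "0 < \<beta>"
  shows "filterlim (tau \<beta>) (at_left (quasi_map \<beta> L)) (at_left L)"
proof -
  have ev: "\<forall>\<^sub>F z in at_left L. \<lfloor>\<beta> * z\<rfloor> = \<lceil>\<beta> * L\<rceil> - 1"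
    using eventually_compose_filterlim[OF eventually_floor_at_left filterlim_mult_at_left[OF assms]] .
  have "((\<lambda>z. \<beta> * z - of_int (\<lceil>\<beta> * L\<rceil> - 1)) \<longlongrightarrow> quasi_map \<beta> L) (at_left L)"
    unfolding quasi_map_def by (intro tendsto_intros)
  then have "(tau \<beta> \<longlongrightarrow> quasi_map \<beta> L) (at_left L)"
    by (rule Lim_transform_eventually) (use ev in eventually_elim, simp add: tau_def)
  moreover have "\<forall>\<^sub>F z in at_left L. tau \<beta> z < quasi_map \<beta> L"
    using ev eventually_at_left_real[of "L - 1" L, simplified]
    by eventually_elim (use assms in \<open>simp add: tau_def quasi_map_def\<close>)
  ultimately show ?thesis
    unfolding filterlim_at by (auto elim: eventually_mono)
qed

lemma filterlim_tau_funpow_at_left: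
  assumes "0 < \<beta>"
  shows "filterlim (tau \<beta> ^^ n) (at_left ((quasi_map \<beta> ^^ n) L)) (at_left L)"
proof (induction n)
  case (Suc n)
  show ?case
    using filterlim_compose[OF filterlim_tau_at_left[OF assms] Suc] by (simp add: o_def)
qed (simp add: filterlim_ident id_def)

lemma tendsto_fun_iff:
  "(f \<longlongrightarrow> l) F \<longleftrightarrow> (\<forall>i. ((\<lambda>y. f y i) \<longlongrightarrow> l i) F)"
proof -
  have "(f \<longlongrightarrow> l) F \<longleftrightarrow> limitin (product_topology (\<lambda>i. euclidean) UNIV) f l F"
    by (simp add: euclidean_product_topology)
  then show ?thesis
    by (simp add: limitin_componentwise)
qed

text \<open>Each digit is eventually constant as y increases to L, and convergence in the product
  topology is coordinatewise.\<close>

lemma tendsto_greedy_at_left: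
  assumes "0 < \<beta>"
  shows "(greedy \<beta> \<longlongrightarrow> quasi_greedy \<beta> L) (at_left L)"
proof -
  have "\<forall>\<^sub>F y in at_left L. greedy \<beta> y n = quasi_greedy \<beta> L n" for n
    using eventually_compose_filterlim[OF eventually_floor_at_left
        filterlim_compose[OF filterlim_mult_at_left[OF assms] filterlim_tau_funpow_at_left[OF assms]],
        of n L]
    by eventually_elim (simp add: greedy_def quasi_greedy_def)
  then have "((\<lambda>y. greedy \<beta> y n) \<longlongrightarrow> quasi_greedy \<beta> L n) (at_left L)" for n
    by (rule tendsto_eventually)
  then show ?thesis
    by (simp add: tendsto_fun_iff)
qed

lemma seq_one_eq_quasi_greedy:
  assumes "0 < \<beta>"
  shows "seq_one \<beta> = quasi_greedy \<beta> 1"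
  unfolding seq_one_def
proof (rule the_equality)
  fix q
  assume "(greedy \<beta> \<longlongrightarrow> q) (at_left 1)"
  then have "((\<lambda>y. greedy \<beta> y n) \<longlongrightarrow> q n) (at_left 1)" for n
    by (simp add: tendsto_fun_iff)
  moreover have "((\<lambda>y. greedy \<beta> y n) \<longlongrightarrow> quasi_greedy \<beta> 1 n) (at_left 1)" for n
    using tendsto_greedy_at_left[OF assms, of 1] by (simp add: tendsto_fun_iff)
  ultimately show "q = quasi_greedy \<beta> 1"
    by (intro ext tendsto_unique[OF trivial_limit_at_left_real])
qed (rule tendsto_greedy_at_left[OF assms])

lemma quasi_map_funpow_pos: "0 < x \<Longrightarrow> 0 < (quasi_map \<beta> ^^ n) x"
  by (cases n) (auto intro: quasi_map_bounds)

lemma quasi_map_funpow_le_one: "x \<le> 1 \<Longrightarrow> (quasi_map \<beta> ^^ n) x \<le> 1"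
  by (cases n) (auto intro: quasi_map_bounds)

text \<open>Positivity of the orbit makes the ceiling at least 1, so \<open>nat\<close> truncates
  nothing in the digits.\<close>

lemma of_nat_quasi_greedy:
  assumes "0 < \<beta>" "0 < x"
  shows "int (quasi_greedy \<beta> x n) = \<lceil>\<beta> * (quasi_map \<beta> ^^ n) x\<rceil> - 1"
proof -
  have "0 < \<beta> * (quasi_map \<beta> ^^ n) x"
    using assms quasi_map_funpow_pos by simp
  then show ?thesis
    unfolding quasi_greedy_def by (simp add: le_ceiling_iff)
qed

lemma quasi_map_funpow_Suc:
  assumes "0 < \<beta>" "0 < x"
  shows "(quasi_map \<beta> ^^ Suc n) x = \<beta> * (quasi_map \<beta> ^^ n) x - real (quasi_greedy \<beta> x n)"
  using of_nat_quasi_greedy[OF assms, of n]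
  by (simp add: quasi_map_def)

text \<open>While the digits agree, both orbits pass through the same increasing affine branch and
  keep their order. At the first disagreement the smaller orbit point cannot have the larger
  digit.\<close>

lemma quasi_greedy_mono:
  assumes "0 < \<beta>" "0 < x" "x \<le> y"
  shows "lex_le (quasi_greedy \<beta> x) (quasi_greedy \<beta> y)"
proof (rule ccontr)
  assume "\<not> ?thesis"
  then obtain k where k: "quasi_greedy \<beta> y k < quasi_greedy \<beta> x k"
    "\<And>i. i < k \<Longrightarrow> quasi_greedy \<beta> y i = quasi_greedy \<beta> x i"
    unfolding not_lex_le less_fun_def by blast
  have "0 < y"
    using assms by simp
  have "i \<le> k \<Longrightarrow> (quasi_map \<beta> ^^ i) x \<le> (quasi_map \<beta> ^^ i) y" for i
  proof (induction i)
    case (Suc i)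
    then show ?case
      using k(2)[of i] assms(1)
      by (simp only: quasi_map_funpow_Suc[OF assms(1,2)] quasi_map_funpow_Suc[OF assms(1) \<open>0 < y\<close>]) auto
  qed (simp add: assms)
  from this[of k] have "\<lceil>\<beta> * (quasi_map \<beta> ^^ k) x\<rceil> \<le> \<lceil>\<beta> * (quasi_map \<beta> ^^ k) y\<rceil>"
    using assms(1) by (intro ceiling_mono mult_left_mono) auto
  then show False
    using k(1) of_nat_quasi_greedy[OF assms(1,2), of k] of_nat_quasi_greedy[OF assms(1) \<open>0 < y\<close>, of k]
    by linarith
qed

lemma funpow_shift_quasi_greedy:
  "(shift ^^ n) (quasi_greedy \<beta> x) = quasi_greedy \<beta> ((quasi_map \<beta> ^^ n) x)"
  by (rule ext) (simp add: funpow_shift quasi_greedy_def funpow_add add.commute[of n])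

section \<open>Admissible sequences and the domains of the inverse branches\<close>

locale beta_param =
  fixes \<beta> :: real
  assumes beta_gt_1: "1 < \<beta>" and beta_le_2: "\<beta> \<le> 2"
begin

lemma beta_pos: "0 < \<beta>"
  using beta_gt_1 by simp

abbreviation "X \<equiv> beta_shift \<beta>"
abbreviation "q \<equiv> seq_one \<beta>"

lemmas seq_one_eq = seq_one_eq_quasi_greedy[OF beta_pos]

lemma seq_one_0: "q 0 = 1"
proof -
  have "\<lceil>\<beta>\<rceil> = 2"
    using beta_gt_1 beta_le_2 by (simp add: ceiling_eq_iff)
  then show ?thesis
    by (simp add: seq_one_eq quasi_greedy_def)
qed

lemma seq_one_le_1: "q n \<le> 1"
proof -
  have "\<beta> * (quasi_map \<beta> ^^ n) 1 \<le> 2 * 1"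
    using beta_pos beta_le_2 quasi_map_funpow_le_one[of 1] quasi_map_funpow_pos[of 1]
    by (intro mult_mono) (auto simp: less_imp_le)
  then have "\<lceil>\<beta> * (quasi_map \<beta> ^^ n) 1\<rceil> \<le> 2"
    by (simp add: ceiling_le_iff)
  then have "nat (\<lceil>\<beta> * (quasi_map \<beta> ^^ n) 1\<rceil> - 1) \<le> 1"
    by linarith
  then show ?thesis
    by (simp add: seq_one_eq quasi_greedy_def)
qed

text \<open>Every shift of \<open>q\<close> is the quasi-greedy expansion of an orbit point of 1.
  Such a point is at most 1, so monotonicity of the expansion applies.\<close>

lemma seq_one_in_X: "q \<in> X"
  unfolding beta_shift_def
proof (intro CollectI conjI allI)
  show "range q \<subseteq> {0, 1}"
    using seq_one_le_1 by (auto simp: le_Suc_eq) (metis not_gr_zero)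
  show "lex_le ((shift ^^ n) q) q" for n
    unfolding seq_one_eq funpow_shift_quasi_greedy
    by (rule quasi_greedy_mono[OF beta_pos quasi_map_funpow_pos quasi_map_funpow_le_one]) simp_all
qed

lemma le_seq_one: "x \<in> X \<Longrightarrow> lex_le x q"
  unfolding beta_shift_def by (metis (mono_tags, lifting) funpow_0 mem_Collect_eq)

lemma digit_in: "x \<in> X \<Longrightarrow> x n \<in> {0, 1}"
  unfolding beta_shift_def by blast

lemma zero_less_seq_one: "less_fun seq_zero q"
  by (rule less_fun_head) (simp add: seq_one_0 seq_zero_def)

lemma seq_zero_in_X: "seq_zero \<in> X"
proof -
  have "(shift ^^ n) seq_zero = seq_zero" for n
    by (simp add: funpow_shift seq_zero_def)
  then show ?thesis
    by (simp add: beta_shift_def seq_zero_lex_le) (auto simp: seq_zero_def)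
qed

lemma shift_in_X:
  assumes "x \<in> X"
  shows "shift x \<in> X"
  unfolding beta_shift_def
proof (intro CollectI conjI allI)
  show "range (shift x) \<subseteq> {0, 1}"
    by (rule image_subsetI) (simp only: shift_def digit_in[OF assms])
  have "lex_le ((shift ^^ Suc n) x) q" for n
    using assms unfolding beta_shift_def by blast
  then show "lex_le ((shift ^^ n) (shift x)) q" for n
    by (simp add: funpow_Suc_right del: funpow.simps(2))
qed

lemma funpow_shift_in_X: "x \<in> X \<Longrightarrow> (shift ^^ n) x \<in> X"
  by (induction n) (auto intro: shift_in_X)

text \<open>All proper tails of \<open>case_nat c x\<close> are tails of \<open>x\<close> and hence
  admissible; only the comparison of the whole sequence with \<open>q\<close> remains.\<close>

lemma case_nat_in_X_iff:
  assumes "x \<in> X" "c \<in> {0, 1}"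
  shows "case_nat c x \<in> X \<longleftrightarrow> lex_le (case_nat c x) q"
proof
  assume le: "lex_le (case_nat c x) q"
  show "case_nat c x \<in> X"
    unfolding beta_shift_def
  proof (intro CollectI conjI allI)
    have "case_nat c x n \<in> {0, 1}" for n
      using assms digit_in by (cases n) (simp_all only: nat.case)
    then show "range (case_nat c x) \<subseteq> {0, 1}"
      by (rule image_subsetI)
    show "lex_le ((shift ^^ n) (case_nat c x)) q" for n
      using le le_seq_one[OF funpow_shift_in_X[OF assms(1)]]
      by (cases n) (simp_all add: funpow_Suc_right del: funpow.simps(2))
  qed
qed (rule le_seq_one)

lemma case_nat_0_in_X: "x \<in> X \<Longrightarrow> case_nat 0 x \<in> X"
  by (subst case_nat_in_X_iff) (simp_all add: lex_le_def less_fun_head seq_one_0)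

text \<open>Since \<open>q\<close> itself begins with 1, the common first digit cancels. Thus the
  domain of the 1-branch is an initial segment of \<open>X\<close>.\<close>

lemma case_nat_1_in_X_iff:
  assumes "x \<in> X"
  shows "case_nat 1 x \<in> X \<longleftrightarrow> lex_le x (shift q)"
proof -
  have "q = case_nat 1 (shift q)"
    using case_nat_shift[of q] by (simp only: seq_one_0)
  then have "lex_le (case_nat 1 x) q \<longleftrightarrow> lex_le x (shift q)"
    by (metis lex_le_case_nat)
  with assms show ?thesis
    by (simp add: case_nat_in_X_iff)
qed

section \<open>Functions of bounded variation\<close>

text \<open>Bounded variation is equivalent to control by a potential: for every \<open>f\<close> in \<open>BV\<close> there is
  a real function whose increments dominate those of \<open>f\<close> (the variation over the initial segment).
  This makes the closure properties of \<open>BV\<close> immediate.\<close>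

definition controls :: "((nat \<Rightarrow> nat) \<Rightarrow> real) \<Rightarrow> seqfun \<Rightarrow> bool" where
  "controls V f \<longleftrightarrow> (\<forall>x\<in>X. \<forall>y\<in>X. lex_le x y \<longrightarrow> norm (f y - f x) \<le> V y - V x)"

text \<open>The numbers \<open>s\<close> are the sums of increments of \<open>f\<close> along finite
  chains from \<open>seq_zero\<close> to \<open>x\<close>. The inductive form makes it easy to
  append a point to a chain.\<close>

inductive initial_var :: "seqfun \<Rightarrow> (nat \<Rightarrow> nat) \<Rightarrow> real \<Rightarrow> bool" for f where
  base: "initial_var f seq_zero 0"
| step: "initial_var f x s \<Longrightarrow> y \<in> X \<Longrightarrow> less_fun x y \<Longrightarrow> initial_var f y (s + norm (f y - f x))"

lemma initial_var_chain:
  assumes "initial_var f x s"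
  shows "\<exists>n c. (\<forall>i\<le>n. c i \<in> X) \<and> c 0 = seq_zero \<and> c n = x \<and> (\<forall>i<n. less_fun (c i) (c (Suc i))) \<and>
    s = (\<Sum>i=1..n. norm (f (c i) - f (c (i - 1))))"
  using assms
proof induction
  case base
  show ?case
    by (intro exI[of _ 0] exI[of _ "\<lambda>_. seq_zero"]) (simp add: seq_zero_in_X)
next
  case (step x s y)
  then obtain n c where c: "\<forall>i\<le>n. c i \<in> X" "c 0 = seq_zero" "c n = x"
    "\<forall>i<n. less_fun (c i) (c (Suc i))" "s = (\<Sum>i=1..n. norm (f (c i) - f (c (i - 1))))"
    by blast
  let ?c = "c(Suc n := y)"
  have "(\<Sum>i=1..n. norm (f (?c i) - f (?c (i - 1)))) = s"
    unfolding c(5) by (intro sum.cong) auto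
  then have "s + norm (f y - f x) = (\<Sum>i=1..Suc n. norm (f (?c i) - f (?c (i - 1))))"
    using c(3) by simp
  moreover have "\<forall>i\<le>Suc n. ?c i \<in> X" "\<forall>i<Suc n. less_fun (?c i) (?c (Suc i))"
    using c step.hyps by (auto simp: less_Suc_eq)
  ultimately show ?case
    using c(2) by (intro exI[of _ "Suc n"] exI[of _ ?c]) auto
qed

lemma initial_var_seq_one: "initial_var f q s \<Longrightarrow> s \<in> var_sums \<beta> f"
  using initial_var_chain[of f q s] unfolding var_sums_def is_chain_def by blast

lemma initial_var_ex:
  assumes "x \<in> X"
  shows "\<exists>s. initial_var f x s"
  using assms initial_var.base initial_var.step[OF initial_var.base] seq_zero_lex_le[of x]
  unfolding lex_le_def by metis

text \<open>The case \<open>x = y\<close> is harmless because the added increment is 0; this spares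
  later case distinctions.\<close>

lemma initial_var_extend:
  assumes "initial_var f x s" "y \<in> X" "lex_le x y"
  shows "initial_var f y (s + norm (f y - f x))"
  using assms initial_var.step[of f x s y] unfolding lex_le_def by auto

lemma initial_var_in_X: "initial_var f x s \<Longrightarrow> x \<in> X"
  by (induction rule: initial_var.induct) (simp_all add: seq_zero_in_X)

text \<open>The potential at \<open>x\<close> is the supremum of the chain sums up to
  \<open>x\<close>. It is finite because a chain ending at \<open>x\<close> can be continued to
  \<open>q\<close>; it dominates increments because a chain ending at \<open>x\<close> can be
  continued to \<open>y\<close>.\<close>

lemma BV_imp_controls:
  assumes "f \<in> BV \<beta>"
  obtains V where "controls V f"
proof -
  from assms obtain M where M: "\<And>s. s \<in> var_sums \<beta> f \<Longrightarrow> s \<le> M"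
    unfolding BV_def bdd_above_def by auto
  have bound: "s \<le> M" if "initial_var f x s" for x s
    using M[OF initial_var_seq_one[OF initial_var_extend[OF that seq_one_in_X]]]
      le_seq_one[OF initial_var_in_X[OF that]] norm_ge_zero[of "f q - f x"]
    by linarith
  define V where "V x = Sup {s. initial_var f x s}" for x
  have "norm (f y - f x) \<le> V y - V x" if "x \<in> X" "y \<in> X" "lex_le x y" for x y
  proof -
    have "s \<le> V y - norm (f y - f x)" if "initial_var f x s" for s
    proof -
      have "s + norm (f y - f x) \<le> V y"
        unfolding V_def
        using initial_var_extend[OF that \<open>y \<in> X\<close> \<open>lex_le x y\<close>] bound
        by (intro cSup_upper) (auto simp: bdd_above_def)
      then show ?thesis by simp
    qed
    then have "V x \<le> V y - norm (f y - f x)"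
      unfolding V_def[of x] using initial_var_ex[OF \<open>x \<in> X\<close>, of f]
      by (intro cSup_least) auto
    then show ?thesis by simp
  qed
  then have "controls V f"
    unfolding controls_def by blast
  then show ?thesis ..
qed

text \<open>The increments of the potential along a chain telescope.\<close>

lemma controls_var_sums:
  assumes "controls V f" "s \<in> var_sums \<beta> f"
  shows "s \<le> V q - V seq_zero"
proof -
  from assms(2) obtain n c where s: "s = (\<Sum>i=1..n. norm (f (c i) - f (c (i - 1))))"
    and c: "is_chain \<beta> n c"
    unfolding var_sums_def by auto
  have "s = (\<Sum>i<n. norm (f (c (Suc i)) - f (c i)))"
    unfolding s by (rule sum.reindex_bij_witness[of _ Suc "\<lambda>i. i - 1"]) auto
  also have "\<dots> \<le> (\<Sum>i<n. V (c (Suc i)) - V (c i))"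
    using assms(1) c by (intro sum_mono) (auto simp: controls_def is_chain_def lex_le_def)
  also have "\<dots> = V q - V seq_zero"
    using c sum_lessThan_telescope[of "\<lambda>i. V (c i)" n] by (simp add: is_chain_def)
  finally show ?thesis .
qed

lemma controls_imp_BV: "controls V f \<Longrightarrow> f \<in> BV \<beta>"
  using controls_var_sums unfolding BV_def bdd_above_def by blast

text \<open>This is the two-point chain from \<open>seq_zero\<close> to \<open>q\<close>. It keeps
  the \<open>Sup\<close> in \<open>var\<close> away from the empty set.\<close>

lemma var_sums_nonempty: "norm (f q - f seq_zero) \<in> var_sums \<beta> f"
proof -
  have "initial_var f q (0 + norm (f q - f seq_zero))"
    by (intro initial_var.intros seq_one_in_X zero_less_seq_one)
  then show ?thesis
    using initial_var_seq_one by simp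
qed

lemma controls_var_le: "controls V f \<Longrightarrow> var \<beta> f \<le> V q - V seq_zero"
  unfolding var_def using controls_var_sums var_sums_nonempty[of f] by (intro cSup_least) auto

lemma var_nonneg: "f \<in> BV \<beta> \<Longrightarrow> 0 \<le> var \<beta> f"
  unfolding var_def BV_def using var_sums_nonempty
  by (intro order_trans[OF norm_ge_zero] cSup_upper) auto

lemma BV_bounded:
  assumes "f \<in> BV \<beta>"
  obtains M where "\<forall>x\<in>X. norm (f x) \<le> M"
proof -
  obtain V where V: "controls V f"
    using BV_imp_controls[OF assms] .
  have "norm (f x) \<le> norm (f q) + (V q - V seq_zero)" if "x \<in> X" for x
  proof -
    have "norm (f q - f x) \<le> V q - V x"
      using V that seq_one_in_X le_seq_one unfolding controls_def by blast
    \<comment> \<open>Serves only to give \<open>V seq_zero \<le> V x\<close>, so that the bound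
      becomes independent of \<open>x\<close>.\<close>
    moreover have "norm (f x - f seq_zero) \<le> V x - V seq_zero"
      using V that seq_zero_in_X seq_zero_lex_le unfolding controls_def by blast
    moreover have "norm (f x) \<le> norm (f q) + norm (f q - f x)"
      by norm
    ultimately show ?thesis
      using norm_ge_zero[of "f x - f seq_zero"] by linarith
  qed
  then show ?thesis
    using that by blast
qed

lemma bv_norm_nonneg:
  assumes "f \<in> BV \<beta>"
  shows "0 \<le> bv_norm \<beta> f"
proof -
  obtain M where M: "\<forall>x\<in>X. norm (f x) \<le> M"
    by (rule BV_bounded[OF assms])
  have "norm (f q) \<le> sup_norm \<beta> f"
    unfolding sup_norm_def using M seq_one_in_X by (intro cSUP_upper) (auto simp: bdd_above_def)
  then have "0 \<le> sup_norm \<beta> f"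
    using norm_ge_zero order_trans by blast
  then show ?thesis
    unfolding bv_norm_def using var_nonneg[OF assms] by simp
qed

lemma BV_zero: "(\<lambda>x. 0) \<in> BV \<beta>"
  by (rule controls_imp_BV[of "\<lambda>x. 0"]) (simp add: controls_def)

lemma BV_add:
  assumes "f \<in> BV \<beta>" "g \<in> BV \<beta>"
  shows "(\<lambda>x. f x + g x) \<in> BV \<beta>"
proof -
  obtain V W where VW: "controls V f" "controls W g"
    using assms BV_imp_controls by metis
  have "controls (\<lambda>x. V x + W x) (\<lambda>x. f x + g x)"
    unfolding controls_def
  proof (intro ballI impI)
    fix x y
    assume *: "x \<in> X" "y \<in> X" "lex_le x y"
    have "norm (f y + g y - (f x + g x)) \<le> norm (f y - f x) + norm (g y - g x)"
      by norm
    also have "\<dots> \<le> (V y - V x) + (W y - W x)"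
      using VW * unfolding controls_def by (intro add_mono) blast+
    finally show "norm (f y + g y - (f x + g x)) \<le> V y + W y - (V x + W x)"
      by simp
  qed
  then show ?thesis
    by (rule controls_imp_BV)
qed

lemma BV_scale:
  assumes "f \<in> BV \<beta>"
  shows "(\<lambda>x. c * f x) \<in> BV \<beta>"
proof -
  obtain V where V: "controls V f"
    using BV_imp_controls[OF assms] .
  have "controls (\<lambda>x. norm c * V x) (\<lambda>x. c * f x)"
    using V unfolding controls_def
    by (auto simp: norm_mult mult_left_mono simp flip: right_diff_distrib)
  then show ?thesis
    by (rule controls_imp_BV)
qed

lemma BV_diff: "f \<in> BV \<beta> \<Longrightarrow> g \<in> BV \<beta> \<Longrightarrow> (\<lambda>x. f x - g x) \<in> BV \<beta>"
  using BV_add[OF _ BV_scale[of g "-1"]] by simp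

lemma BV_cong:
  assumes "f \<in> BV \<beta>" "\<And>x. x \<in> X \<Longrightarrow> f x = g x"
  shows "g \<in> BV \<beta>"
proof -
  obtain V where "controls V f"
    using BV_imp_controls[OF assms(1)] .
  then have "controls V g"
    unfolding controls_def using assms(2) by simp
  then show ?thesis
    by (rule controls_imp_BV)
qed

text \<open>The potential counts the thresholds already passed, one on reaching \<open>a\<close> and
  one on leaving \<open>b\<close>. The indicator can change only when a threshold is
  crossed.\<close>

lemma controls_indicator_interval:
  "controls (\<lambda>x. indicator {x. lex_le a x} x + indicator {x. less_fun b x} x)
     (indicator (seq_interval \<beta> a b))"
  unfolding controls_def
proof (intro ballI impI)
  fix x y
  assume *: "x \<in> X" "y \<in> X" "lex_le x y"
  have "lex_le a x \<Longrightarrow> lex_le a y" "lex_le y b \<Longrightarrow> lex_le x b"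
    using * by (blast intro: lex_le_trans)+
  with * show "norm (indicator (seq_interval \<beta> a b) y - indicator (seq_interval \<beta> a b) x :: complex)
    \<le> indicator {x. lex_le a x} y + indicator {x. less_fun b x} y
      - (indicator {x. lex_le a x} x + indicator {x. less_fun b x} x)"
    by (auto simp: indicator_def seq_interval_def simp flip: not_lex_le)
qed

text \<open>For an initial interval the lower threshold is already passed at
  \<open>seq_zero\<close>, so sup norm and variation contribute at most 1 each. The bound is uniform
  in \<open>a\<close>.\<close>

lemma bv_norm_indicator_le: "bv_norm \<beta> (indicator (seq_interval \<beta> seq_zero a)) \<le> 2"
proof -
  have "sup_norm \<beta> (indicator (seq_interval \<beta> seq_zero a)) \<le> 1"
    unfolding sup_norm_def using seq_one_in_X by (intro cSUP_least) (auto simp: indicator_def)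
  moreover have "var \<beta> (indicator (seq_interval \<beta> seq_zero a)) \<le> 1"
    using controls_var_le[OF controls_indicator_interval[of seq_zero a]]
    by (auto simp: seq_zero_lex_le indicator_def of_bool_def split: if_splits)
  ultimately show ?thesis
    unfolding bv_norm_def by simp
qed

lemma BV_indicator_interval: "indicator (seq_interval \<beta> a b) \<in> BV \<beta>"
  by (rule controls_imp_BV[OF controls_indicator_interval])

section \<open>The quotient by null functions\<close>

lemma mem_cls_iff:
  assumes "f \<in> BV \<beta>"
  shows "g \<in> cls \<beta> f \<longleftrightarrow> g \<in> BV \<beta> \<and> countable {x \<in> X. f x \<noteq> g x}"
  using assms by (auto simp: cls_def null_rel_def null_fun_def BV_diff)

lemma self_mem_cls: "f \<in> BV \<beta> \<Longrightarrow> f \<in> cls \<beta> f"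
  by (simp add: mem_cls_iff)

lemma cls_subset:
  assumes "f \<in> BV \<beta>" "g \<in> BV \<beta>" "countable {x \<in> X. f x \<noteq> g x}"
  shows "cls \<beta> g \<subseteq> cls \<beta> f"
proof
  fix h
  assume "h \<in> cls \<beta> g"
  with assms(2) have h: "h \<in> BV \<beta>" "countable {x \<in> X. g x \<noteq> h x}"
    by (simp_all add: mem_cls_iff)
  have "countable {x \<in> X. f x \<noteq> h x}"
    by (rule countable_subset[OF _ countable_Un[OF assms(3) h(2)]]) auto
  with h(1) assms(1) show "h \<in> cls \<beta> f"
    by (simp add: mem_cls_iff)
qed

lemma cls_eqI:
  assumes "f \<in> BV \<beta>" "g \<in> BV \<beta>" "countable {x \<in> X. f x \<noteq> g x}"
  shows "cls \<beta> f = cls \<beta> g"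
proof -
  have "{x \<in> X. g x \<noteq> f x} = {x \<in> X. f x \<noteq> g x}"
    by auto
  then show ?thesis
    using cls_subset[OF assms] cls_subset[of g f] assms by auto
qed

lemma cls_cong:
  assumes "f \<in> BV \<beta>" "\<And>x. x \<in> X \<Longrightarrow> f x = g x"
  shows "cls \<beta> f = cls \<beta> g"
proof -
  have "{x \<in> X. f x \<noteq> g x} = {}"
    using assms(2) by auto
  then have "countable {x \<in> X. f x \<noteq> g x}"
    by (simp only: countable_empty)
  with assms(1) BV_cong[OF assms] show ?thesis
    by (rule cls_eqI)
qed

text \<open>Changing representatives alters the sum only on the union of two countable sets, so the
  union in \<open>q_add\<close> is over copies of one class.\<close>

lemma q_add_cls:
  assumes "f \<in> BV \<beta>" "g \<in> BV \<beta>"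
  shows "q_add \<beta> (cls \<beta> f) (cls \<beta> g) = cls \<beta> (\<lambda>x. f x + g x)"
proof -
  have "cls \<beta> (\<lambda>x. f' x + g' x) = cls \<beta> (\<lambda>x. f x + g x)"
    if "f' \<in> cls \<beta> f" "g' \<in> cls \<beta> g" for f' g'
  proof -
    from that assms have *: "f' \<in> BV \<beta>" "g' \<in> BV \<beta>"
      "countable {x \<in> X. f x \<noteq> f' x}" "countable {x \<in> X. g x \<noteq> g' x}"
      by (simp_all add: mem_cls_iff)
    have "countable {x \<in> X. f x + g x \<noteq> f' x + g' x}"
      by (rule countable_subset[OF _ countable_Un[OF *(3,4)]]) auto
    then show ?thesis
      using assms * by (intro cls_eqI[symmetric] BV_add)
  qed
  then show ?thesis
    unfolding q_add_def using self_mem_cls[OF assms(1)] self_mem_cls[OF assms(2)] by blast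
qed

lemma q_scale_cls:
  assumes "f \<in> BV \<beta>"
  shows "q_scale \<beta> c (cls \<beta> f) = cls \<beta> (\<lambda>x. c * f x)"
proof -
  have "cls \<beta> (\<lambda>x. c * f' x) = cls \<beta> (\<lambda>x. c * f x)" if "f' \<in> cls \<beta> f" for f'
  proof -
    from that assms have *: "f' \<in> BV \<beta>" "countable {x \<in> X. f x \<noteq> f' x}"
      by (simp_all add: mem_cls_iff)
    have "countable {x \<in> X. c * f x \<noteq> c * f' x}"
      by (rule countable_subset[OF _ *(2)]) auto
    then show ?thesis
      using assms * by (intro cls_eqI[symmetric] BV_scale)
  qed
  then show ?thesis
    unfolding q_scale_def using self_mem_cls[OF assms(1)] by blast
qed

lemma q_diff_cls:
  assumes "f \<in> BV \<beta>" "g \<in> BV \<beta>"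
  shows "q_diff \<beta> (cls \<beta> f) (cls \<beta> g) = cls \<beta> (\<lambda>x. f x - g x)"
  unfolding q_diff_def q_scale_cls[OF assms(2)] q_add_cls[OF assms(1) BV_scale[OF assms(2)]]
  by simp

lemma q_norm_cls_le:
  assumes "f \<in> BV \<beta>"
  shows "q_norm \<beta> (cls \<beta> f) \<le> bv_norm \<beta> f"
  unfolding q_norm_def
proof (rule cINF_lower)
  show "bdd_below (bv_norm \<beta> ` cls \<beta> f)"
    using assms by (intro bdd_belowI[of _ 0]) (auto simp: mem_cls_iff bv_norm_nonneg)
qed (rule self_mem_cls[OF assms])

lemma q_norm_nonneg:
  assumes "f \<in> BV \<beta>"
  shows "0 \<le> q_norm \<beta> (cls \<beta> f)"
  unfolding q_norm_def
proof (rule cINF_greatest)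
  show "cls \<beta> f \<noteq> {}"
    using self_mem_cls[OF assms] by blast
qed (use assms in \<open>simp add: mem_cls_iff bv_norm_nonneg\<close>)

lemma q_norm_zero: "q_norm \<beta> (cls \<beta> (\<lambda>x. 0)) \<le> 0"
proof -
  have "var \<beta> (\<lambda>x. 0) \<le> 0"
    using controls_var_le[of "\<lambda>x. 0" "\<lambda>x. 0"] by (simp add: controls_def)
  moreover have "X \<noteq> {}"
    using seq_one_in_X by blast
  then have "sup_norm \<beta> (\<lambda>x. 0) = 0"
    by (simp add: sup_norm_def)
  ultimately have "bv_norm \<beta> (\<lambda>x. 0) \<le> 0"
    by (simp add: bv_norm_def)
  then show ?thesis
    using q_norm_cls_le[OF BV_zero] by simp
qed

lemma cls_in_B_space: "f \<in> BV \<beta> \<Longrightarrow> cls \<beta> f \<in> B_space \<beta>"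
  unfolding B_space_def cls_def by (rule quotientI)

lemma B_spaceE:
  assumes "A \<in> B_space \<beta>"
  obtains f where "f \<in> BV \<beta>" "A = cls \<beta> f"
  using assms unfolding B_space_def cls_def by (auto elim: quotientE)

section \<open>Step functions and their closure\<close>

lemma step_fun_single:
  assumes "a \<in> X" "b \<in> X"
  shows "(\<lambda>x. c * indicator (seq_interval \<beta> a b) x) \<in> step_fun \<beta>"
  unfolding step_fun_def using assms
  by (intro CollectI exI[of _ 1] exI[of _ "\<lambda>_. c"] exI[of _ "\<lambda>_. a"] exI[of _ "\<lambda>_. b"]) simp

lemma step_fun_zero: "(\<lambda>x. 0) \<in> step_fun \<beta>"
  unfolding step_fun_def by (intro CollectI exI[of _ 0]) simp

text \<open>The partial sums of a representation are again step functions, so intervals can be added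
  one at a time instead of handling indexed sums.\<close>

lemma step_fun_induct [consumes 1, case_names zero add]:
  assumes "s \<in> step_fun \<beta>"
    and "P (\<lambda>x. 0)"
    and add: "\<And>s c a b. s \<in> step_fun \<beta> \<Longrightarrow> P s \<Longrightarrow> a \<in> X \<Longrightarrow> b \<in> X \<Longrightarrow>
      P (\<lambda>x. s x + c * indicator (seq_interval \<beta> a b) x)"
  shows "P s"
proof -
  from assms(1) obtain n and c :: "nat \<Rightarrow> complex" and a b
    where s: "s = (\<lambda>x. \<Sum>k<n. c k * indicator (seq_interval \<beta> (a k) (b k)) x)"
      and ab: "\<forall>k<n. a k \<in> X \<and> b k \<in> X"
    unfolding step_fun_def by blast
  let ?s = "\<lambda>m x. \<Sum>k<m. c k * indicator (seq_interval \<beta> (a k) (b k)) x"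
  have "m \<le> n \<Longrightarrow> P (?s m)" for m
  proof (induction m)
    case (Suc m)
    have "?s m \<in> step_fun \<beta>"
      unfolding step_fun_def using ab Suc.prems
      by (intro CollectI exI[of _ m] exI[of _ c] exI[of _ a] exI[of _ b]) auto
    then show ?case
      using add[of "?s m" "a m" "b m" "c m"] Suc ab by simp
  qed (simp add: assms(2))
  then show ?thesis
    unfolding s by simp
qed

lemma step_fun_add_single:
  assumes "s \<in> step_fun \<beta>" "a \<in> X" "b \<in> X"
  shows "(\<lambda>x. s x + d * indicator (seq_interval \<beta> a b) x) \<in> step_fun \<beta>"
proof -
  from assms(1) obtain n and c :: "nat \<Rightarrow> complex" and a' b'
    where s: "s = (\<lambda>x. \<Sum>k<n. c k * indicator (seq_interval \<beta> (a' k) (b' k)) x)"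
      and ab: "\<forall>k<n. a' k \<in> X \<and> b' k \<in> X"
    unfolding step_fun_def by blast
  show ?thesis
    unfolding step_fun_def s using ab assms(2,3)
    by (intro CollectI exI[of _ "Suc n"] exI[of _ "c(n := d)"] exI[of _ "a'(n := a)"]
        exI[of _ "b'(n := b)"]) (auto simp: less_Suc_eq)
qed

lemma step_fun_diff:
  assumes "s \<in> step_fun \<beta>" "u \<in> step_fun \<beta>"
  shows "(\<lambda>x. s x - u x) \<in> step_fun \<beta>"
  using assms(2)
proof (induction rule: step_fun_induct)
  case (add u c a b)
  then show ?case
    using step_fun_add_single[of "\<lambda>x. s x - u x" a b "- c"] by (simp add: algebra_simps)
qed (simp add: assms(1))

lemma step_fun_in_BV: "s \<in> step_fun \<beta> \<Longrightarrow> s \<in> BV \<beta>"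
  by (induction rule: step_fun_induct)
    (intro BV_zero BV_add BV_scale BV_indicator_interval; assumption)+

text \<open>If \<open>u\<close> approximates \<open>f\<close>, then \<open>u - s\<close>
  approximates \<open>f - s\<close> with the same error. The density argument needs the remainder
  \<open>f - s\<close> to lie where the functional is additive and bounded.\<close>

lemma F_space_diff_step:
  assumes "f \<in> BV \<beta>" "cls \<beta> f \<in> F_space \<beta>" "s \<in> step_fun \<beta>"
  shows "cls \<beta> (\<lambda>x. f x - s x) \<in> F_space \<beta>"
  unfolding F_space_def
proof (intro CollectI conjI allI impI)
  have fs: "(\<lambda>x. f x - s x) \<in> BV \<beta>"
    by (intro BV_diff assms step_fun_in_BV)
  then show "cls \<beta> (\<lambda>x. f x - s x) \<in> B_space \<beta>"
    by (rule cls_in_B_space)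
  fix \<epsilon> :: real
  assume "0 < \<epsilon>"
  then obtain u where u: "u \<in> step_fun \<beta>" "q_norm \<beta> (q_diff \<beta> (cls \<beta> f) (cls \<beta> u)) < \<epsilon>"
    using assms(2) unfolding F_space_def by blast
  have us: "(\<lambda>x. u x - s x) \<in> step_fun \<beta>"
    by (rule step_fun_diff[OF u(1) assms(3)])
  have "q_diff \<beta> (cls \<beta> (\<lambda>x. f x - s x)) (cls \<beta> (\<lambda>x. u x - s x)) = q_diff \<beta> (cls \<beta> f) (cls \<beta> u)"
    using q_diff_cls[OF fs step_fun_in_BV[OF us]] q_diff_cls[OF assms(1) step_fun_in_BV[OF u(1)]]
    by simp
  then show "\<exists>u\<in>step_fun \<beta>. q_norm \<beta> (q_diff \<beta> (cls \<beta> (\<lambda>x. f x - s x)) (cls \<beta> u)) < \<epsilon>"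
    using u(2) us by (intro bexI[of _ "\<lambda>x. u x - s x"]) simp_all
qed

lemma step_fun_in_F_space:
  assumes "s \<in> step_fun \<beta>"
  shows "cls \<beta> s \<in> F_space \<beta>"
  unfolding F_space_def
proof (intro CollectI conjI allI impI)
  show "cls \<beta> s \<in> B_space \<beta>"
    by (intro cls_in_B_space step_fun_in_BV assms)
  fix \<epsilon> :: real
  assume "0 < \<epsilon>"
  then show "\<exists>u\<in>step_fun \<beta>. q_norm \<beta> (q_diff \<beta> (cls \<beta> s) (cls \<beta> u)) < \<epsilon>"
    using q_diff_cls[of s s] step_fun_in_BV[OF assms] q_norm_zero assms
    by (intro bexI[of _ s]) simp_all
qed

lemma chi_cls_in_F_space:
  assumes "a \<in> X" "b \<in> X"
  shows "chi_cls \<beta> a b \<in> F_space \<beta>"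
  unfolding chi_cls_def using step_fun_in_F_space[OF step_fun_single[OF assms, of 1]] by simp

section \<open>The transfer operator on classes\<close>

text \<open>A point has the preimage 0x, of weight 1, and also 1x, of weight \<open>exp t\<close>,
  when that is admissible.\<close>

lemma transfer_fun_eq:
  assumes "x \<in> X"
  shows "transfer_fun \<beta> t f x =
    f (case_nat 0 x) + (if lex_le x (shift q) then of_real (exp t) * f (case_nat 1 x) else 0)"
proof -
  have ne: "case_nat (0::nat) x \<noteq> case_nat 1 x"
    by (metis old.nat.simps(4) zero_neq_one)
  have "{y. y \<in> X \<and> shift y = x} =
    (if lex_le x (shift q) then {case_nat 0 x, case_nat 1 x} else {case_nat 0 x})"
    using case_nat_0_in_X[OF assms] case_nat_1_in_X_iff[OF assms] digit_in shift_eq_iff[of _ x]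
    by (auto; metis)
  then show ?thesis
    unfolding transfer_fun_def
    using ne case_nat_0_in_X[OF assms] case_nat_1_in_X_iff[OF assms]
    by (simp add: cyl_one_def)
qed

lemma BV_case_nat_0:
  assumes "f \<in> BV \<beta>"
  shows "(\<lambda>x. f (case_nat 0 x)) \<in> BV \<beta>"
proof -
  obtain V where "controls V f"
    using BV_imp_controls[OF assms] .
  then have "controls (\<lambda>x. V (case_nat 0 x)) (\<lambda>x. f (case_nat 0 x))"
    by (simp add: controls_def case_nat_0_in_X)
  then show ?thesis
    by (rule controls_imp_BV)
qed

lemma BV_case_nat_1:
  assumes "f \<in> BV \<beta>"
  shows "(\<lambda>x. if lex_le x (shift q) then f (case_nat 1 x) else 0) \<in> BV \<beta>"
proof -
  obtain V where V: "controls V f"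
    using BV_imp_controls[OF assms] .
  \<comment> \<open>Beyond \<open>shift q\<close> the function drops to 0. The final value
    \<open>V q + norm (f q)\<close> pays for this drop, as \<open>norm (f (case_nat 1 x))\<close> is
    at most \<open>norm (f q) + V q - V (case_nat 1 x)\<close>.\<close>
  define W where
    "W x = (if lex_le x (shift q) then V (case_nat 1 x) else V q + norm (f q))" for x
  have "controls W (\<lambda>x. if lex_le x (shift q) then f (case_nat 1 x) else 0)"
    unfolding controls_def
  proof (intro ballI impI)
    fix x y
    assume *: "x \<in> X" "y \<in> X" "lex_le x y"
    consider "lex_le x (shift q)" "lex_le y (shift q)" | "lex_le x (shift q)" "\<not> lex_le y (shift q)"
      | "\<not> lex_le x (shift q)" "\<not> lex_le y (shift q)"
      using lex_le_trans[OF *(3)] by blast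
    then show "norm ((if lex_le y (shift q) then f (case_nat 1 y) else 0)
        - (if lex_le x (shift q) then f (case_nat 1 x) else 0)) \<le> W y - W x"
    proof cases
      case 1
      then show ?thesis
        using V * case_nat_1_in_X_iff by (simp add: W_def controls_def)
    next
      case 2
      have "case_nat 1 x \<in> X"
        using case_nat_1_in_X_iff * 2 by simp
      then have "norm (f q - f (case_nat 1 x)) \<le> V q - V (case_nat 1 x)"
        using V le_seq_one seq_one_in_X unfolding controls_def by blast
      moreover have "norm (f (case_nat 1 x)) \<le> norm (f q) + norm (f q - f (case_nat 1 x))"
        by norm
      ultimately show ?thesis
        using 2 by (simp add: W_def)
    qed (simp add: W_def)
  qed
  then show ?thesis
    by (rule controls_imp_BV)
qed

lemma BV_transfer_fun:
  assumes "f \<in> BV \<beta>"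
  shows "transfer_fun \<beta> t f \<in> BV \<beta>"
  by (rule BV_cong[OF BV_add[OF BV_case_nat_0[OF assms]
        BV_scale[OF BV_case_nat_1[OF assms], of "of_real (exp t)"]]])
    (simp add: transfer_fun_eq)

text \<open>Where two transfers differ, the functions differ at some preimage. The exceptional set
  thus lies in the shift image of a countable set.\<close>

lemma transfer_cls:
  assumes "f \<in> BV \<beta>"
  shows "transfer \<beta> t (cls \<beta> f) = cls \<beta> (transfer_fun \<beta> t f)"
proof -
  have "cls \<beta> (transfer_fun \<beta> t g) = cls \<beta> (transfer_fun \<beta> t f)" if "g \<in> cls \<beta> f" for g
  proof -
    from that assms have g: "g \<in> BV \<beta>" "countable {x \<in> X. f x \<noteq> g x}"
      by (simp_all add: mem_cls_iff)
    have "{x \<in> X. transfer_fun \<beta> t f x \<noteq> transfer_fun \<beta> t g x} \<subseteq> shift ` {x \<in> X. f x \<noteq> g x}"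
    proof
      fix x
      assume x: "x \<in> {x \<in> X. transfer_fun \<beta> t f x \<noteq> transfer_fun \<beta> t g x}"
      have "\<exists>y. y \<in> X \<and> shift y = x \<and> f y \<noteq> g y"
      proof (rule ccontr)
        assume "\<not> ?thesis"
        then have "transfer_fun \<beta> t f x = transfer_fun \<beta> t g x"
          unfolding transfer_fun_def by (intro sum.cong) auto
        with x show False by simp
      qed
      then show "x \<in> shift ` {x \<in> X. f x \<noteq> g x}"
        by blast
    qed
    then have "countable {x \<in> X. transfer_fun \<beta> t f x \<noteq> transfer_fun \<beta> t g x}"
      by (rule countable_subset[OF _ countable_image[OF g(2)]])
    then show ?thesis
      using assms g(1) by (intro cls_eqI[symmetric] BV_transfer_fun)
  qed
  then show ?thesis
    unfolding transfer_def using self_mem_cls[OF assms] by blast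
qed

text \<open>If \<open>a\<close> starts with 1, the 0-branch maps \<open>X\<close> into \<open>[0, a]\<close>, and every \<open>x \<le> \<sigma> a\<close> lies in the
  domain of the 1-branch because \<open>1x \<le> a \<le> q\<close>.\<close>

lemma transfer_fun_indicator:
  assumes "a \<in> X" "x \<in> X"
  shows "transfer_fun \<beta> t (indicator (seq_interval \<beta> seq_zero a)) x =
    of_nat (a 0) * indicator (seq_interval \<beta> seq_zero q) x +
    of_real (exp (t * a 0)) * indicator (seq_interval \<beta> seq_zero (shift a)) x"
proof -
  have a: "a = case_nat (a 0) (shift a)"
    by (simp add: case_nat_shift)
  have le_iff: "lex_le (case_nat (a 0) x) a \<longleftrightarrow> lex_le x (shift a)"
    by (subst a) simp
  consider "a 0 = 0" | "a 0 = 1"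
    using digit_in[OF assms(1), of 0] by (auto simp only: insert_iff empty_iff)
  then show ?thesis
  proof cases
    case 1
    \<comment> \<open>With first digit 0 in \<open>a\<close>, the point 1x lies above
      \<open>a\<close>, so only the 0-branch contributes, with weight 1.\<close>
    then have "\<not> lex_le (case_nat 1 x) a"
      by (simp add: not_lex_le less_fun_head)
    with 1 le_iff assms case_nat_0_in_X show ?thesis
      by (simp add: transfer_fun_eq seq_interval_def seq_zero_lex_le indicator_def)
  next
    case 2
    then have "lex_le (case_nat 0 x) a"
      by (simp add: lex_le_def less_fun_head)
    moreover have "lex_le x (shift q)" if "lex_le x (shift a)"
    proof -
      have "lex_le (case_nat 1 x) q"
        using that le_iff 2 le_seq_one[OF assms(1)] lex_le_trans by metis
      then show ?thesis
        using case_nat_in_X_iff[of x 1] case_nat_1_in_X_iff assms(2) by simp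
    qed
    ultimately show ?thesis
      using 2 le_iff assms case_nat_0_in_X case_nat_1_in_X_iff le_seq_one
      by (auto simp add: transfer_fun_eq seq_interval_def seq_zero_lex_le indicator_def)
  qed
qed

lemma transfer_chi_cls:
  assumes "a \<in> X"
  shows "transfer \<beta> t (chi_cls \<beta> seq_zero a) =
    q_add \<beta> (q_scale \<beta> (of_nat (a 0)) (chi_cls \<beta> seq_zero q))
      (q_scale \<beta> (of_real (exp (t * a 0))) (chi_cls \<beta> seq_zero (shift a)))"
  unfolding chi_cls_def transfer_cls[OF BV_indicator_interval] q_scale_cls[OF BV_indicator_interval]
    q_add_cls[OF BV_scale[OF BV_indicator_interval] BV_scale[OF BV_indicator_interval]]
  by (rule cls_cong[OF BV_transfer_fun[OF BV_indicator_interval] transfer_fun_indicator[OF assms]])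

end

section \<open>The functional equation\<close>

lemma H_Suc: "H (Suc n) t a = H n t a * exp (t * a n)"
  by (simp add: H_def distrib_left exp_add)

locale eigenfunctional = beta_param +
  fixes t :: real and l :: complex and \<nu> :: "seqfun set \<Rightarrow> complex"
  assumes dual: "\<nu> \<in> F_dual \<beta>"
    and eigen: "A \<in> F_space \<beta> \<Longrightarrow> transfer_dual \<beta> t \<nu> A = l * \<nu> A"
    and growth: "r_bound \<beta> t < ereal (norm l)"
begin

abbreviation "\<phi> a \<equiv> \<nu> (chi_cls \<beta> seq_zero a)"

lemma \<nu>_add: "A \<in> F_space \<beta> \<Longrightarrow> B \<in> F_space \<beta> \<Longrightarrow> \<nu> (q_add \<beta> A B) = \<nu> A + \<nu> B"
  using dual unfolding F_dual_def by blast

lemma \<nu>_scale: "A \<in> F_space \<beta> \<Longrightarrow> \<nu> (q_scale \<beta> c A) = c * \<nu> A"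
  using dual unfolding F_dual_def by blast

text \<open>Passing to the absolute value of the constant makes it nonnegative, which later
  estimates need in order to multiply inequalities by it.\<close>

lemma \<nu>_bounded:
  obtains K where "0 \<le> K"
    "\<forall>f\<in>BV \<beta>. cls \<beta> f \<in> F_space \<beta> \<longrightarrow> norm (\<nu> (cls \<beta> f)) \<le> K * q_norm \<beta> (cls \<beta> f)"
proof -
  obtain K where K: "\<forall>A\<in>F_space \<beta>. norm (\<nu> A) \<le> K * q_norm \<beta> A"
    using dual unfolding F_dual_def by blast
  have "norm (\<nu> (cls \<beta> f)) \<le> \<bar>K\<bar> * q_norm \<beta> (cls \<beta> f)" if "f \<in> BV \<beta>" "cls \<beta> f \<in> F_space \<beta>" for f
  proof -
    have "norm (\<nu> (cls \<beta> f)) \<le> K * q_norm \<beta> (cls \<beta> f)"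
      using K that by blast
    also have "\<dots> \<le> \<bar>K\<bar> * q_norm \<beta> (cls \<beta> f)"
      by (intro mult_right_mono q_norm_nonneg that) simp
    finally show ?thesis .
  qed
  then show ?thesis
    using that[of "\<bar>K\<bar>"] by simp
qed

lemma q_scale_chi_cls_in_F_space:
  assumes "a \<in> X" "b \<in> X"
  shows "q_scale \<beta> c (chi_cls \<beta> a b) \<in> F_space \<beta>"
  unfolding chi_cls_def q_scale_cls[OF BV_indicator_interval]
  by (rule step_fun_in_F_space[OF step_fun_single[OF assms]])

lemma \<phi>_step:
  assumes "a \<in> X"
  shows "l * \<phi> a = of_nat (a 0) * \<phi> q + of_real (exp (t * a 0)) * \<phi> (shift a)"
proof -
  note in_X = seq_zero_in_X seq_one_in_X assms shift_in_X[OF assms]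
  have "l * \<phi> a = \<nu> (transfer \<beta> t (chi_cls \<beta> seq_zero a))"
    using eigen[OF chi_cls_in_F_space[OF seq_zero_in_X assms]] by (simp add: transfer_dual_def)
  then show ?thesis
    by (simp only: transfer_chi_cls[OF assms] \<nu>_add \<nu>_scale q_scale_chi_cls_in_F_space
        chi_cls_in_F_space in_X)
qed

text \<open>The indicators of initial intervals have BV norm at most 2, whatever their
  endpoint.\<close>

lemma \<phi>_bounded:
  obtains M where "\<forall>a\<in>X. norm (\<phi> a) \<le> M"
proof -
  obtain K where K: "0 \<le> K" "\<forall>f\<in>BV \<beta>. cls \<beta> f \<in> F_space \<beta> \<longrightarrow>
      norm (\<nu> (cls \<beta> f)) \<le> K * q_norm \<beta> (cls \<beta> f)"
    by (rule \<nu>_bounded)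
  have "norm (\<phi> a) \<le> K * 2" if "a \<in> X" for a
  proof -
    have "norm (\<phi> a) \<le> K * q_norm \<beta> (chi_cls \<beta> seq_zero a)"
      unfolding chi_cls_def
      by (intro K(2)[rule_format] BV_indicator_interval chi_cls_in_F_space[unfolded chi_cls_def]
          seq_zero_in_X that)
    also have "\<dots> \<le> K * 2"
      unfolding chi_cls_def
      using q_norm_cls_le[OF BV_indicator_interval] bv_norm_indicator_le K(1)
      by (intro mult_left_mono) (rule order_trans)
    finally show ?thesis .
  qed
  then show ?thesis
    using that by blast
qed

section \<open>Growth of the weights and the series expansion\<close>

lemma birkhoff_sum_cyl_one:
  assumes "a \<in> X"
  shows "birkhoff_sum n (indicator (cyl_one \<beta>)) a = (\<Sum>i<n. real (a i))"
  unfolding birkhoff_sum_def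
proof (rule sum.cong)
  fix i
  have "(shift ^^ i) a 0 = a i"
    by (simp add: funpow_shift)
  then show "indicator (cyl_one \<beta>) ((shift ^^ i) a) = real (a i)"
    using funpow_shift_in_X[OF assms, of i] digit_in[OF assms, of i]
    by (auto simp: cyl_one_def indicator_def)
qed simp

lemma H_le_sup_norm:
  assumes "a \<in> X"
  shows "H n t a \<le> sup_norm \<beta> (\<lambda>x. of_real (exp (t * birkhoff_sum n (indicator (cyl_one \<beta>)) x)))"
    (is "_ \<le> sup_norm \<beta> ?E")
proof -
  \<comment> \<open>A crude bound, needed only to make the supremum in \<open>sup_norm\<close>
    finite.\<close>
  have "norm (?E x) \<le> exp (\<bar>t\<bar> * n)" if "x \<in> X" for x
  proof -
    have "(\<Sum>i<n. real (x i)) \<le> (\<Sum>i<n. 1)"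
      using digit_in[OF that] by (intro sum_mono) (auto simp: le_Suc_eq)
    then have "\<bar>t\<bar> * (\<Sum>i<n. real (x i)) \<le> \<bar>t\<bar> * n"
      by (intro mult_left_mono) simp_all
    moreover have "t * (\<Sum>i<n. real (x i)) \<le> \<bar>t\<bar> * (\<Sum>i<n. real (x i))"
      by (intro mult_right_mono sum_nonneg) simp_all
    ultimately show ?thesis
      by (simp add: birkhoff_sum_cyl_one[OF that])
  qed
  then have "norm (?E a) \<le> sup_norm \<beta> ?E"
    unfolding sup_norm_def using assms by (intro cSUP_upper) (auto simp: bdd_above_def)
  then show ?thesis
    by (simp add: H_def birkhoff_sum_cyl_one[OF assms])
qed

text \<open>Choose \<open>r\<close> strictly between the limsup and the modulus of \<open>l\<close>.
  Eventually the n-th root of the sup norm is below \<open>r\<close>, which bounds all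
  \<open>H n t a\<close> simultaneously.\<close>

lemma H_growth:
  obtains r where "0 < r" "r < norm l" "\<forall>\<^sub>F n in sequentially. \<forall>a\<in>X. H n t a \<le> r ^ n"
proof -
  let ?s = "\<lambda>n. sup_norm \<beta> (\<lambda>x. of_real (exp (t * birkhoff_sum n (indicator (cyl_one \<beta>)) x)))"
  obtain r where r: "r_bound \<beta> t < ereal r" "ereal r < ereal (norm l)"
    using ereal_dense2[OF growth] by blast
  have "\<forall>\<^sub>F n in sequentially. ereal (root n (?s n)) < ereal r"
    using r(1) unfolding r_bound_def by (rule Limsup_lessD)
  then have ev: "\<forall>\<^sub>F n in sequentially. root n (?s n) < r \<and> 0 < n"
    using eventually_gt_at_top[of 0] by eventually_elim simp
  \<comment> \<open>The weight at \<open>q\<close> is a positive lower bound, so taking the n-th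
    root can be undone by the n-th power and \<open>r\<close> is positive.\<close>
  have s_pos: "0 < ?s n" for n
    using H_le_sup_norm[OF seq_one_in_X, of n] by (simp add: H_def less_le_trans[OF exp_gt_zero])
  obtain n where "root n (?s n) < r" "0 < n"
    using ev eventually_happens[OF ev] by auto
  then have "0 < r"
    using s_pos[of n] real_root_gt_zero less_trans by blast
  moreover have "\<forall>\<^sub>F n in sequentially. \<forall>a\<in>X. H n t a \<le> r ^ n"
    using ev
  proof eventually_elim
    case (elim n)
    then have "?s n = root n (?s n) ^ n"
      using s_pos[of n] by simp
    also have "\<dots> \<le> r ^ n"
      using elim s_pos[of n] by (intro power_mono) (auto intro: real_root_ge_zero less_imp_le)
    finally show ?case
      using H_le_sup_norm order_trans by blast
  qed
  ultimately show ?thesis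
    using r(2) that by simp
qed

lemma l_nonzero: "l \<noteq> 0"
  by (rule H_growth) auto

lemma \<phi>_iterate:
  assumes "a \<in> X"
  shows "\<phi> a = \<phi> q * (\<Sum>n<N. of_nat (a n) * of_real (H n t a) / l ^ Suc n)
    + of_real (H N t a) / l ^ N * \<phi> ((shift ^^ N) a)"
proof (induction N)
  case 0
  show ?case by (simp add: H_def)
next
  case (Suc N)
  have "(shift ^^ N) a 0 = a N"
    by (simp add: funpow_shift)
  \<comment> \<open>The one-step equation at the \<open>N\<close>-th shift of \<open>a\<close>; its
    factor \<open>exp (t * a N)\<close> turns \<open>H N t a\<close> into
    \<open>H (Suc N) t a\<close>.\<close>
  then have "\<phi> ((shift ^^ N) a) =
    (of_nat (a N) * \<phi> q + of_real (exp (t * a N)) * \<phi> ((shift ^^ Suc N) a)) / l"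
    using \<phi>_step[OF funpow_shift_in_X[OF assms, of N]] l_nonzero by (simp add: field_simps)
  with Suc.IH show ?case
    using l_nonzero by (simp add: H_Suc field_simps)
qed

text \<open>Digits are at most 1 and the weights at most \<open>r ^ n\<close> eventually, so the
  series is dominated by a geometric one of ratio \<open>r / norm l\<close>. The same ratio and the
  boundedness of \<phi> send the remainder to 0.\<close>

lemma \<phi>_expansion:
  assumes "a \<in> X"
  shows "summable (\<lambda>n. of_nat (a n) * of_real (H n t a) / l ^ Suc n)"
    and "\<phi> a = \<phi> q * (\<Sum>n. of_nat (a n) * of_real (H n t a) / l ^ Suc n)"
proof -
  let ?f = "\<lambda>n. of_nat (a n) * of_real (H n t a) / l ^ Suc n"
  obtain r where r: "0 < r" "r < norm l" "\<forall>\<^sub>F n in sequentially. \<forall>a\<in>X. H n t a \<le> r ^ n"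
    by (rule H_growth)
  have ratio: "norm (r / norm l) < 1"
    using r(1,2) by (simp add: divide_less_eq)
  have H_le: "\<forall>\<^sub>F n in sequentially. norm (of_real (H n t a) / l ^ n) \<le> (r / norm l) ^ n"
    using r(3)
    by eventually_elim
      (use assms in \<open>simp add: norm_divide norm_power power_divide divide_right_mono H_def\<close>)
  have "\<forall>\<^sub>F n in sequentially. norm (?f n) \<le> (r / norm l) ^ n * (1 / norm l)"
    using H_le
  proof eventually_elim
    case (elim n)
    \<comment> \<open>The weight with index \<open>n\<close> stands over the power
      \<open>Suc n\<close> of \<open>l\<close>; splitting off one factor \<open>1 / l\<close>
      matches the indices.\<close>
    have "?f n = of_nat (a n) * ((of_real (H n t a) / l ^ n) * (1 / l))"
      by simp
    moreover have "norm (of_nat (a n) :: complex) \<le> 1"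
      using digit_in[OF assms, of n] by auto
    ultimately have "norm (?f n) \<le> 1 * ((r / norm l) ^ n * (1 / norm l))"
      using elim by (simp only: norm_mult norm_divide[of 1] norm_one)
        (intro mult_mono mult_right_mono mult_nonneg_nonneg; simp)
    then show ?case by simp
  qed
  then show sm: "summable ?f"
    by (rule summable_comparison_test_ev) (intro summable_mult2 summable_geometric ratio)
  obtain M where M: "\<forall>a\<in>X. norm (\<phi> a) \<le> M"
    by (rule \<phi>_bounded)
  have "(\<lambda>N. of_real (H N t a) / l ^ N * \<phi> ((shift ^^ N) a)) \<longlonglongrightarrow> 0"
  proof (rule Lim_null_comparison)
    show "\<forall>\<^sub>F N in sequentially. norm (of_real (H N t a) / l ^ N * \<phi> ((shift ^^ N) a))
      \<le> (r / norm l) ^ N * M"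
      using H_le
    proof eventually_elim
      case (elim N)
      show ?case
        unfolding norm_mult using elim bspec[OF M funpow_shift_in_X[OF assms]] r(1)
        by (intro mult_mono) auto
    qed
    show "(\<lambda>N. (r / norm l) ^ N * M) \<longlonglongrightarrow> 0"
      using LIMSEQ_power_zero[OF ratio] by (rule tendsto_mult_left_zero)
  qed
  moreover have "(\<lambda>N. \<phi> q * (\<Sum>n<N. ?f n)) \<longlonglongrightarrow> \<phi> q * (\<Sum>n. ?f n)"
    by (intro tendsto_intros summable_LIMSEQ sm)
  ultimately have "(\<lambda>N. \<phi> q * (\<Sum>n<N. ?f n) + of_real (H N t a) / l ^ N * \<phi> ((shift ^^ N) a))
    \<longlonglongrightarrow> \<phi> q * (\<Sum>n. ?f n) + 0"
    by (intro tendsto_add)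
  \<comment> \<open>By the iterated equation, partial sum plus remainder equals \<phi>(a) for every
    \<open>N\<close>, so the sequence is constant.\<close>
  then have "(\<lambda>N. \<phi> a) \<longlonglongrightarrow> \<phi> q * (\<Sum>n. ?f n)"
    by (simp only: \<phi>_iterate[OF assms, symmetric] add_0_right)
  then show "\<phi> a = \<phi> q * (\<Sum>n. ?f n)"
    by (simp add: LIMSEQ_const_iff)
qed

section \<open>Nonvanishing\<close>

text \<open>Removing the single point \<open>a\<close> does not change the class, so modulo null functions the
  indicator of \<open>[a, b]\<close> is a difference of indicators of initial intervals.\<close>

lemma chi_cls_eq_diff:
  assumes "lex_le a b"
  shows "chi_cls \<beta> a b = q_add \<beta> (chi_cls \<beta> seq_zero b) (q_scale \<beta> (-1) (chi_cls \<beta> seq_zero a))"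
  unfolding chi_cls_def q_scale_cls[OF BV_indicator_interval]
    q_add_cls[OF BV_indicator_interval BV_scale[OF BV_indicator_interval]]
proof (rule cls_eqI)
  have "indicator (seq_interval \<beta> a b) x = (indicator (seq_interval \<beta> seq_zero b) x
    + - 1 * indicator (seq_interval \<beta> seq_zero a) x :: complex)" if x: "x \<in> X" "x \<noteq> a" for x
  proof -
    consider "less_fun x a" | "less_fun a x"
      using less_fun_linear[of x a] x(2) by blast
    then show ?thesis
    proof cases
      case 1
      then have "lex_le x a" "\<not> lex_le a x"
        by (simp_all only: not_lex_le) (simp add: lex_le_def)
      moreover have "lex_le x b"
        using \<open>lex_le x a\<close> assms by (rule lex_le_trans)
      ultimately show ?thesis
        using x by (simp add: seq_interval_def indicator_def seq_zero_lex_le)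
    next
      case 2
      then have "lex_le a x" "\<not> lex_le x a"
        by (simp_all only: not_lex_le) (simp add: lex_le_def)
      then show ?thesis
        using x by (simp add: seq_interval_def indicator_def seq_zero_lex_le)
    qed
  qed
  then have "{x \<in> X. indicator (seq_interval \<beta> a b) x \<noteq> (indicator (seq_interval \<beta> seq_zero b) x
    + - 1 * indicator (seq_interval \<beta> seq_zero a) x :: complex)} \<subseteq> {a}"
    by blast
  then show "countable {x \<in> X. indicator (seq_interval \<beta> a b) x \<noteq>
    (indicator (seq_interval \<beta> seq_zero b) x
      + - 1 * indicator (seq_interval \<beta> seq_zero a) x :: complex)}"
    by (rule countable_subset) simp
qed (intro BV_add BV_scale BV_indicator_interval)+

lemma \<nu>_chi_cls_eq_0:
  assumes "\<phi> q = 0" "a \<in> X" "b \<in> X"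
  shows "\<nu> (chi_cls \<beta> a b) = 0"
proof (cases "lex_le a b")
  case True
  then show ?thesis
    using \<phi>_expansion(2)[OF assms(2)] \<phi>_expansion(2)[OF assms(3)] assms seq_zero_in_X
    by (simp add: chi_cls_eq_diff \<nu>_add \<nu>_scale chi_cls_in_F_space q_scale_chi_cls_in_F_space)
next
  case False
  \<comment> \<open>For \<open>b\<close> below \<open>a\<close> the interval is empty. Its class is
    then 0 times itself, so homogeneity gives the value 0.\<close>
  then have "cls \<beta> (indicator (seq_interval \<beta> a b)) = cls \<beta> (\<lambda>x. 0 * indicator (seq_interval \<beta> a b) x)"
    by (intro cls_cong BV_indicator_interval) (auto simp: seq_interval_def indicator_def intro: lex_le_trans)
  then have "chi_cls \<beta> a b = q_scale \<beta> 0 (chi_cls \<beta> a b)"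
    unfolding chi_cls_def q_scale_cls[OF BV_indicator_interval] .
  then show ?thesis
    using \<nu>_scale[OF chi_cls_in_F_space[OF assms(2,3)], of 0] by simp
qed

lemma \<nu>_step_eq_0:
  assumes "\<phi> q = 0" "s \<in> step_fun \<beta>"
  shows "\<nu> (cls \<beta> s) = 0"
  using assms(2)
proof (induction rule: step_fun_induct)
  case zero
  have "cls \<beta> (\<lambda>x. 0) = q_scale \<beta> 0 (cls \<beta> (\<lambda>x. 0))"
    by (simp add: q_scale_cls[OF BV_zero])
  then show ?case
    using \<nu>_scale[OF step_fun_in_F_space[OF step_fun_zero], of 0] by simp
next
  case (add s c a b)
  have "cls \<beta> (\<lambda>x. s x + c * indicator (seq_interval \<beta> a b) x) =
      q_add \<beta> (cls \<beta> s) (q_scale \<beta> c (chi_cls \<beta> a b))"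
    unfolding chi_cls_def q_scale_cls[OF BV_indicator_interval]
      q_add_cls[OF step_fun_in_BV[OF add(1)] BV_scale[OF BV_indicator_interval]] ..
  with add \<nu>_chi_cls_eq_0[OF assms(1)] show ?case
    by (simp add: \<nu>_add \<nu>_scale step_fun_in_F_space chi_cls_in_F_space q_scale_chi_cls_in_F_space)
qed

text \<open>Write \<open>f\<close> as \<open>(f - s) + s\<close> with a step function
  \<open>s\<close> close to \<open>f\<close>. The functional kills \<open>s\<close>, and boundedness
  makes its value at \<open>f - s\<close> arbitrarily small.\<close>

lemma \<nu>_eq_0:
  assumes "\<phi> q = 0" "A \<in> F_space \<beta>"
  shows "\<nu> A = 0"
proof -
  obtain f where f: "f \<in> BV \<beta>" "A = cls \<beta> f"
    using assms(2) unfolding F_space_def by (auto elim: B_spaceE)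
  obtain K where K: "0 \<le> K" "\<forall>f\<in>BV \<beta>. cls \<beta> f \<in> F_space \<beta> \<longrightarrow>
      norm (\<nu> (cls \<beta> f)) \<le> K * q_norm \<beta> (cls \<beta> f)"
    by (rule \<nu>_bounded)
  have "norm (\<nu> A) \<le> K * \<epsilon>" if "0 < \<epsilon>" for \<epsilon>
  proof -
    obtain s where s: "s \<in> step_fun \<beta>" "q_norm \<beta> (q_diff \<beta> A (cls \<beta> s)) < \<epsilon>"
      using assms(2) \<open>0 < \<epsilon>\<close> unfolding F_space_def by blast
    have s_BV: "s \<in> BV \<beta>"
      by (rule step_fun_in_BV[OF s(1)])
    have fs: "(\<lambda>x. f x - s x) \<in> BV \<beta>" "cls \<beta> (\<lambda>x. f x - s x) \<in> F_space \<beta>"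
      using assms(2) f s(1) s_BV by (auto intro: BV_diff F_space_diff_step)
    have "A = q_add \<beta> (cls \<beta> (\<lambda>x. f x - s x)) (cls \<beta> s)"
      using q_add_cls[OF fs(1) s_BV] f(2) by simp
    then have "\<nu> A = \<nu> (cls \<beta> (\<lambda>x. f x - s x))"
      using \<nu>_add[OF fs(2) step_fun_in_F_space[OF s(1)]] \<nu>_step_eq_0[OF assms(1) s(1)] by simp
    also have "norm \<dots> \<le> K * q_norm \<beta> (cls \<beta> (\<lambda>x. f x - s x))"
      using K(2) fs by blast
    also have "\<dots> \<le> K * \<epsilon>"
      using s(2) f K(1) q_diff_cls[OF f(1) s_BV] by (intro mult_left_mono) auto
    finally show ?thesis .
  qed
  then have "norm (\<nu> A) \<le> 0 + e" if "0 < e" for e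
  proof -
    \<comment> \<open>The denominator \<open>K + 1\<close> instead of \<open>K\<close> covers the
      case \<open>K = 0\<close>.\<close>
    have "norm (\<nu> A) \<le> K * (e / (K + 1))"
      using K(1) that by (intro \<open>\<And>\<epsilon>. 0 < \<epsilon> \<Longrightarrow> norm (\<nu> A) \<le> K * \<epsilon>\<close>) simp
    also have "\<dots> \<le> e"
      using K(1) that by (simp add: field_simps)
    finally show ?thesis by simp
  qed
  then have "norm (\<nu> A) \<le> 0"
    by (rule field_le_epsilon)
  then show ?thesis by simp
qed

end

theorem theorem3p3:
  fixes \<beta> t :: real and l :: complex and \<nu> :: "seqfun set \<Rightarrow> complex"
  assumes "1 < \<beta>" and "\<beta> \<le> 2"
    and "isolated_eigenvalue \<beta> t l"
    and "r_bound \<beta> t < ereal (norm l)"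
    and "\<nu> \<in> F_dual \<beta>"
    and "\<exists>A\<in>F_space \<beta>. \<nu> A \<noteq> 0"
    and "\<forall>A\<in>F_space \<beta>. transfer_dual \<beta> t \<nu> A = l * \<nu> A"
  shows "(\<forall>a\<in>beta_shift \<beta>.
            summable (\<lambda>n. of_nat (a n) * of_real (H n t a) / l ^ Suc n) \<and>
            \<nu> (chi_cls \<beta> seq_zero a) = \<nu> (chi_cls \<beta> seq_zero (seq_one \<beta>)) *
              (\<Sum>n. of_nat (a n) * of_real (H n t a) / l ^ Suc n)) \<and>
         \<nu> (chi_cls \<beta> seq_zero (seq_one \<beta>)) \<noteq> 0"
proof -
  interpret eigenfunctional \<beta> t l \<nu>
    by unfold_locales (use assms in auto)
  from assms(6) obtain A where "A \<in> F_space \<beta>" "\<nu> A \<noteq> 0" ..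
  then have "\<phi> (seq_one \<beta>) \<noteq> 0"
    using \<nu>_eq_0 by metis
  then show ?thesis
    using \<phi>_expansion by simp
qed

end
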